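(* Let $\mathcal{C}\subset[0,1)$ be the Cantor-like set and $\mathcal{C}_\infty\subset\mathcal{C}$ its set of dissipative points, as defined in the context. Then $$\dim_H(\mathcal{C}_\infty)=\dim_H(\mathcal{C})=1,$$ where $\dim_H$ denotes the Hausdorff dimension.
   Context: $\mathbb{N}=\{1,2,\dots\}$, $\mathbb{N}_0=\mathbb{N}\cup\{0\}$; $|J|$ is the length of an interval $J$. All intervals are half-open (closed on the left, open on the right). A finite or infinite sequence $(k_1,k_2,\dots)$ is called admissible if $k_1\in\mathbb{N}$, $k_i\in\mathbb{N}_0$ for all $i\ge 2$, and $k_i=0$ implies $k_{i+1}\neq 0$. To each finite admissible sequence $(k_1,\dots,k_n)$, $n\ge1$, one associates an interval $I_{k_1\cdots k_n}\subset[0,1)$ inductively. Level 1: for $k\in\mathbb{N}$, $I_k:=\left[\frac{3}{\pi^2}\sum_{j=1}^{k-1}j^{-2},\ \frac{3}{\pi^2}\sum_{j=1}^{k}j^{-2}\right)$. Level $n+1$: given $J=I_{k_1\cdots k_n}=[a,b)$, put $k:=k_n$. (i) For every $l\in\mathbb{N}$, $I_{k_1\cdots k_n\,(k+l)}:=\left[a+\frac{3|J|}{\pi^2}\sum_{j=1}^{l-1}j^{-2},\ a+\frac{3|J|}{\pi^2}\sum_{j=1}^{l}j^{-2}\right)$ (these partition the left half of $J$). (ii) If $k\ge1$, one also inserts in the right half of $J$, adjacently and starting from the right endpoint, the intervals with last index $k,k-1,\dots,0$: $I_{k_1\cdots k_n\,k}:=\left[b-\frac{3|J|}{\pi^2(2k)^2},\,b\right)$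 and, for $1\le l\le k$, $I_{k_1\cdots k_n\,(k-l)}:=\left[b-\frac{3|J|}{\pi^2}\left(\frac1{(2k)^2}+\sum_{j=1}^{l}j^{-2}\right),\ b-\frac{3|J|}{\pi^2}\left(\frac1{(2k)^2}+\sum_{j=1}^{l-1}j^{-2}\right)\right)$. (If $k=0$ only the intervals in (i) are constructed.) Let $C_n$ be the family of all $I_{k_1\cdots k_n}$ with $(k_1,\dots,k_n)$ admissible; its members are pairwise disjoint. Define $\mathcal{C}:=\bigcap_{n\in\mathbb{N}}\bigcup_{I\in C_n}I$. Each $x\in\mathcal{C}$ has a unique code, namely the infinite admissible sequence $(k_n)_{n\in\mathbb{N}}$ with $x\in I_{k_1\cdots k_n}$ for all $n$. The set of dissipative points is $$\mathcal{C}_\infty:=\{x\in\mathcal{C}:\ \text{the code }(k_n)\text{ of }x\text{ satisfies }\lim_{n\to\infty}k_n=\infty\}.$$ *)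

theory Defs
  imports "HOL-Analysis.Analysis"
begin

section \<open>Hausdorff dimension\<close>

text \<open>
  The summand for a covering set. The case \<open>s = 0\<close> is separate because
  \<open>0 powr 0 = 0\<close> in HOL, whereas a nonempty set has to contribute \<open>1\<close> to the counting measure.
\<close>
definition diam_powr :: "real \<Rightarrow> 'a::metric_space set \<Rightarrow> ennreal" where
  "diam_powr s U =
     (if U = {} then 0 else if s = 0 then 1 else ennreal (diameter U powr s))"

text \<open>
  Boundedness is required explicitly since \<^const>\<open>diameter\<close> is unspecified on unbounded sets.
  Covers by finitely many sets are included, as the members of a cover may be empty.
\<close>
definition hausdorff_premeasure :: "real \<Rightarrow> real \<Rightarrow> 'a::metric_space set \<Rightarrow> ennreal" where
  "hausdorff_premeasure s \<delta> A =
     (INF U \<in> {U :: nat \<Rightarrow> 'a set.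
                 (\<forall>i. bounded (U i) \<and> diameter (U i) \<le> \<delta>) \<and> A \<subseteq> (\<Union>i. U i)}.
        \<Sum>i. diam_powr s (U i))"

definition hausdorff_measure :: "real \<Rightarrow> 'a::metric_space set \<Rightarrow> ennreal" where
  "hausdorff_measure s A = (SUP \<delta> \<in> {0<..}. hausdorff_premeasure s \<delta> A)"

definition hausdorff_dim :: "'a::metric_space set \<Rightarrow> ennreal" where
  "hausdorff_dim A = Inf {ennreal s | s. 0 \<le> s \<and> hausdorff_measure s A = 0}"

section \<open>The Cantor-like set\<close>

text \<open>
  Intervals \<open>[a, b)\<close> are represented by the pair \<open>(a, b)\<close> of their endpoints during the
  construction.
\<close>

definition first_interval :: "nat \<Rightarrow> real \<times> real" where
  "first_interval k =
     (3 / pi\<^sup>2 * (\<Sum>j = 1..<k. 1 / (real j)\<^sup>2), 3 / pi\<^sup>2 * (\<Sum>j = 1..k. 1 / (real j)\<^sup>2))"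

text \<open>
  \<open>child k (a, b) m\<close> is the subinterval with new index \<open>m\<close> of the interval \<open>[a, b)\<close> whose last
  index is \<open>k\<close>. For \<open>k = m = 0\<close> nothing is constructed; the value there is irrelevant,
  because only admissible sequences are ever used.
\<close>
definition child :: "nat \<Rightarrow> real \<times> real \<Rightarrow> nat \<Rightarrow> real \<times> real" where
  "child k J m =
     (let a = fst J; b = snd J; c = 3 * (b - a) / pi\<^sup>2 in
      if k < m then
        let l = m - k in
          (a + c * (\<Sum>j = 1..<l. 1 / (real j)\<^sup>2),
           a + c * (\<Sum>j = 1..l. 1 / (real j)\<^sup>2))
      else if m = k then
        (b - c * (1 / (2 * real k)\<^sup>2), b)
      else
        let l = k - m in
          (b - c * (1 / (2 * real k)\<^sup>2 + (\<Sum>j = 1..l. 1 / (real j)\<^sup>2)),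
           b - c * (1 / (2 * real k)\<^sup>2 + (\<Sum>j = 1..<l. 1 / (real j)\<^sup>2))))"

fun descend :: "nat \<Rightarrow> real \<times> real \<Rightarrow> nat list \<Rightarrow> real \<times> real" where
  "descend k J [] = J"
| "descend k J (m # ms) = descend m (child k J m) ms"

text \<open>The empty sequence is not admissible; its value is a dummy.\<close>
fun endpoints :: "nat list \<Rightarrow> real \<times> real" where
  "endpoints [] = (0, 1)"
| "endpoints (k # ks) = descend k (first_interval k) ks"

definition code_interval :: "nat list \<Rightarrow> real set" where
  "code_interval ks = {fst (endpoints ks)..<snd (endpoints ks)}"

definition admissible :: "nat list \<Rightarrow> bool" where
  "admissible ks \<longleftrightarrow>
     ks \<noteq> [] \<and> 1 \<le> hd ks \<and>
     (\<forall>i. Suc i < length ks \<longrightarrow> ks ! i = 0 \<longrightarrow> ks ! Suc i \<noteq> 0)"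

text \<open>
  Infinite sequences \<open>(k\<^sub>1, k\<^sub>2, \<dots>)\<close> are functions indexed from \<open>0\<close>: \<open>k i\<close> is the index
  \<open>k\<^sub>i\<^sub>+\<^sub>1\<close>.
\<close>
definition admissible_seq :: "(nat \<Rightarrow> nat) \<Rightarrow> bool" where
  "admissible_seq k \<longleftrightarrow> 1 \<le> k 0 \<and> (\<forall>i. k i = 0 \<longrightarrow> k (Suc i) \<noteq> 0)"

definition level_intervals :: "nat \<Rightarrow> real set set" where
  "level_intervals n = {code_interval ks | ks. admissible ks \<and> length ks = n}"

definition cantor_like :: "real set" where
  "cantor_like = (\<Inter>n\<in>{1..}. \<Union> (level_intervals n))"

definition is_code :: "real \<Rightarrow> (nat \<Rightarrow> nat) \<Rightarrow> bool" where
  "is_code x k \<longleftrightarrow> admissible_seq k \<and> (\<forall>n\<ge>1. x \<in> code_interval (map k [0..<n]))"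

text \<open>Every point of \<^const>\<open>cantor_like\<close> has exactly one code.\<close>
definition dissipative_points :: "real set" where
  "dissipative_points =
     {x \<in> cantor_like. \<exists>k. is_code x k \<and> filterlim k at_top sequentially}"

end

theory Submission
  imports Defs "HOL-Probability.Infinite_Product_Measure"
begin

text \<open>
  A child whose index differs by \<open>l \<noteq> 0\<close> from the index of its parent has relative length
  \<open>p(l) = 3 / (\<pi>\<^sup>2 l\<^sup>2)\<close>, whatever the parent is. The numbers \<open>p(l)\<close> are the step probabilities of a
  symmetric random walk on the integers: they sum to \<open>1\<close>. Since \<open>p(l) < 1\<close>, for every \<open>s < 1\<close>
  the sum of \<open>p(l)\<^sup>s\<close> exceeds \<open>1\<close>, and so does the sum \<open>S\<close> over some finite range
  \<open>0 < \<bar>l\<bar> \<le> M\<close> (\<open>exists_large_jump_sum\<close>). This surplus pays for forcing the walk upwards.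

  Consider words of \<open>n\<close> jumps from that range. Their ratios (products of the \<open>p(l)\<close>), raised to the
  power \<open>s\<close>, add up to \<open>S\<^sup>n\<close>, but only \<open>(n + 1)\<^sup>M\<close> values of the ratio can occur, so a single value
  \<open>\<rho>\<close> carries an exponentially large part of the sum. By the symmetry \<open>l \<mapsto> -l\<close>, at least half of
  the words of ratio \<open>\<rho>\<close> have nonnegative sum; appending one jump \<open>+1\<close> makes the sum positive. For
  \<open>n\<close> large this yields a set \<open>W\<close> of words of the same length and with the same ratio, called
  \<open>\<rho>\<close> again, such that every word has positive sum and \<open>card W * \<rho>\<^sup>s \<ge> 1\<close> (\<open>exists_word_set\<close>).

  Start in a first-level interval of index so large that no word can bring the index down to \<open>0\<close>.
  Any infinite concatenation of words from \<open>W\<close> is then the sequence of jumps of an admissible code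
  tending to infinity. The intervals reached after \<open>n\<close> words are pairwise disjoint and all have
  \<open>\<rho>\<^sup>n\<close> times the initial length. Hence a set of diameter about \<open>\<rho>\<^sup>n\<close> meets boundedly many of them
  and has mass of order \<open>(card W)\<^sup>-\<^sup>n \<le> \<rho>\<^sup>n\<^sup>s\<close> for the uniform product measure on sequences of
  words. By the mass distribution principle (\<open>hausdorff_measure_pos\<close>) the \<open>s\<close>-dimensional measure of
  the dissipative set does not vanish. The upper bound \<open>1\<close> is that of the unit interval.
\<close>

section \<open>Elementary facts about Hausdorff dimension\<close>

lemma hausdorff_premeasure_mono:
  "A \<subseteq> B \<Longrightarrow> hausdorff_premeasure s \<delta> A \<le> hausdorff_premeasure s \<delta> B"
  unfolding hausdorff_premeasure_def by (rule INF_superset_mono) auto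

lemma hausdorff_measure_mono: "A \<subseteq> B \<Longrightarrow> hausdorff_measure s A \<le> hausdorff_measure s B"
  unfolding hausdorff_measure_def by (intro SUP_mono' hausdorff_premeasure_mono)

text \<open>
  Cutting into \<open>n\<close> intervals of length \<open>1 / n\<close> costs \<open>n * n\<^sup>-\<^sup>s\<close>, which tends to \<open>0\<close>.
\<close>
lemma hausdorff_measure_unit_interval:
  fixes s :: real assumes "1 < s"
  shows "hausdorff_measure s {0..1::real} = 0"
proof -
  have "hausdorff_premeasure s \<delta> {0..1::real} = 0" if "\<delta> > 0" for \<delta> :: real
  proof -
    have le: "hausdorff_premeasure s \<delta> {0..1::real} \<le> ennreal (real n powr (1 - s))"
      if n: "n > 0" "1 / real n \<le> \<delta>" for n :: nat
    proof -
      define U :: "nat \<Rightarrow> real set"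
        where "U i = (if i < n then {real i / n .. real (Suc i) / n} else {})" for i
      have diam: "diameter (U i) = 1 / n" if "i < n" for i
        using that n by (simp add: U_def diameter_closed_interval field_simps)
      have bd: "bounded (U i) \<and> diameter (U i) \<le> \<delta>" for i
        using diam[of i] n \<open>\<delta> > 0\<close> by (cases "i < n") (auto simp: U_def)
      have cover: "{0..1} \<subseteq> (\<Union>i. U i)"
      proof
        fix x :: real assume x: "x \<in> {0..1}"
        show "x \<in> (\<Union>i. U i)"
        proof (cases "x = 1")
          case True
          then have "x \<in> U (n - 1)" using n by (simp add: U_def field_simps of_nat_diff)
          then show ?thesis by blast
        next
          case False
          define i where "i = nat \<lfloor>x * n\<rfloor>"
          have i: "real i \<le> x * n" "x * n < real i + 1"
            using x by (auto simp: i_def)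
          have "x * n < n" using x False n by simp
          with i have "i < n" by linarith
          with i n have "x \<in> U i" by (simp add: U_def field_simps)
          then show ?thesis by blast
        qed
      qed
      have "hausdorff_premeasure s \<delta> {0..1::real} \<le> (\<Sum>i. diam_powr s (U i))"
        unfolding hausdorff_premeasure_def using bd cover by (intro INF_lower) auto
      also have "\<dots> = (\<Sum>i<n. diam_powr s (U i))"
        by (rule suminf_finite) (auto simp: U_def diam_powr_def)
      also have "\<dots> = (\<Sum>i<n. ennreal ((1 / n) powr s))"
        using assms diam by (intro sum.cong) (auto simp: diam_powr_def U_def field_simps)
      also have "\<dots> = ennreal (n * (1 / n) powr s)"
        by (subst sum_ennreal) auto
      also have "n * (1 / n) powr s = real n powr (1 - s)"
        using n by (simp add: powr_divide powr_diff)
      finally show ?thesis .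
    qed
    have "(\<lambda>n. ennreal (real n powr (1 - s))) \<longlonglongrightarrow> ennreal 0"
      using assms by (intro tendsto_ennrealI tendsto_neg_powr filterlim_real_sequentially) auto
    moreover have "eventually (\<lambda>n. hausdorff_premeasure s \<delta> {0..1::real} \<le>
        ennreal (real n powr (1 - s))) sequentially"
    proof -
      obtain n0 :: nat where n0: "n0 > 0" "1 / real n0 < \<delta>"
        using \<open>\<delta> > 0\<close> reals_Archimedean[of \<delta>] by (metis inverse_eq_divide zero_less_Suc)
      have "1 / real n \<le> \<delta>" if "n \<ge> n0" for n
      proof -
        have "1 / real n \<le> 1 / real n0" using that n0 by (intro divide_left_mono) auto
        with n0 show ?thesis by simp
      qed
      then show ?thesis
        using n0 le unfolding eventually_sequentially
        by (metis less_le_trans)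
    qed
    ultimately have "hausdorff_premeasure s \<delta> {0..1::real} \<le> ennreal 0"
      by (intro tendsto_lowerbound) auto
    then show ?thesis by simp
  qed
  then show ?thesis unfolding hausdorff_measure_def by simp
qed

lemma hausdorff_dim_le_1:
  assumes "A \<subseteq> {0..1::real}"
  shows "hausdorff_dim A \<le> 1"
proof -
  have "hausdorff_dim A \<le> ennreal s" if "1 < s" for s
    unfolding hausdorff_dim_def
    using hausdorff_measure_mono[OF assms, of s] hausdorff_measure_unit_interval[OF that] that
    by (intro Inf_lower) auto
  then have "hausdorff_dim A \<le> ennreal (1 + inverse (Suc n))" for n :: nat
    by (simp del: ennreal_plus)
  moreover have "(\<lambda>n. ennreal (1 + inverse (Suc n))) \<longlonglongrightarrow> ennreal (1 + 0)"
    by (intro tendsto_ennrealI tendsto_intros LIMSEQ_inverse_real_of_nat)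
  ultimately show ?thesis
    by (intro tendsto_lowerbound[of _ 1 sequentially]) auto
qed

lemma hausdorff_measure_empty: "hausdorff_measure s {} = 0"
proof -
  have "hausdorff_premeasure s \<delta> ({} :: 'a set) = 0" if "\<delta> > 0" for \<delta>
  proof -
    have "hausdorff_premeasure s \<delta> ({} :: 'a set) \<le> (\<Sum>i::nat. diam_powr s ({} :: 'a set))"
      unfolding hausdorff_premeasure_def using that by (intro INF_lower) simp
    then show ?thesis by (simp add: diam_powr_def)
  qed
  then show ?thesis by (simp add: hausdorff_measure_def)
qed

lemma hausdorff_dim_ge_1:
  assumes "\<And>s. \<lbrakk>0 \<le> s; s < 1\<rbrakk> \<Longrightarrow> hausdorff_measure s A \<noteq> 0"
  shows "1 \<le> hausdorff_dim A"
  unfolding hausdorff_dim_def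
proof (rule Inf_greatest)
  fix d assume "d \<in> {ennreal s |s. 0 \<le> s \<and> hausdorff_measure s A = 0}"
  then obtain s where "d = ennreal s" "0 \<le> s" "hausdorff_measure s A = 0" by blast
  with assms[of s] show "1 \<le> d" by (cases "s < 1") auto
qed

text \<open>
  The case \<open>s = 0\<close> has to be treated apart: the mass distribution principle below rests on the decay
  of the powers of \<open>\<rho> powr s\<close>, which fails for \<open>s = 0\<close>.
\<close>
lemma hausdorff_measure_0_nonempty:
  assumes "A \<noteq> {}"
  shows "hausdorff_measure 0 A \<noteq> 0"
proof -
  obtain x where x: "x \<in> A" using assms by blast
  have "1 \<le> hausdorff_premeasure 0 1 A"
    unfolding hausdorff_premeasure_def
  proof (rule INF_greatest)
    fix U :: "nat \<Rightarrow> 'a set"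
    assume "U \<in> {U. (\<forall>i. bounded (U i) \<and> diameter (U i) \<le> 1) \<and> A \<subseteq> (\<Union>i. U i)}"
    then obtain i where "x \<in> U i" using x by blast
    then have "1 = diam_powr 0 (U i)" by (auto simp: diam_powr_def)
    also have "\<dots> = (\<Sum>i\<in>{i}. diam_powr 0 (U i))" by simp
    also have "\<dots> \<le> (\<Sum>i. diam_powr 0 (U i))"
      by (rule sum_le_suminf) auto
    finally show "1 \<le> (\<Sum>i. diam_powr 0 (U i))" .
  qed
  also have "\<dots> \<le> hausdorff_measure 0 A"
    unfolding hausdorff_measure_def by (rule SUP_upper) auto
  finally show ?thesis by auto
qed

section \<open>Lower bounds for Hausdorff measure from uniform Cantor schemes\<close>

text \<open>
  One level of the mass distribution principle. The points coded by \<open>\<omega>\<close> lie in intervals of length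
  \<open>r\<close> with left endpoints \<open>a n \<omega>\<close>, and a set of diameter at most \<open>r\<close> confines these left endpoints
  to a window of length \<open>3 * r\<close>. Cutting the window into pieces of length \<open>r\<close>, the codes with
  left endpoint in a given piece share their first \<open>n\<close> letters, so they lie in one cylinder. The
  conclusion speaks of a measurable superset because the coding map \<open>x\<close> need not be measurable.
\<close>
lemma mass_distribution_cover:
  fixes W :: "'w set" and a :: "nat \<Rightarrow> (nat \<Rightarrow> 'w) \<Rightarrow> real"
    and x :: "(nat \<Rightarrow> 'w) \<Rightarrow> real"
  defines "P \<equiv> PiM UNIV (\<lambda>_::nat. uniform_count_measure W)"
  assumes W: "finite W" "W \<noteq> {}"
    and "r > 0"
    and sep: "\<And>\<omega> \<omega>'. \<lbrakk>range \<omega> \<subseteq> W; range \<omega>' \<subseteq> W; \<exists>i<n. \<omega> i \<noteq> \<omega>' i\<rbrakk>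
                \<Longrightarrow> r \<le> \<bar>a n \<omega> - a n \<omega>'\<bar>"
    and x: "\<And>\<omega>. range \<omega> \<subseteq> W \<Longrightarrow> a n \<omega> \<le> x \<omega> \<and> x \<omega> < a n \<omega> + r"
    and U: "bounded U" "diameter U \<le> r"
  shows "\<exists>A \<in> sets P. {\<omega>. range \<omega> \<subseteq> W \<and> x \<omega> \<in> U} \<subseteq> A
           \<and> emeasure P A \<le> ennreal (4 / real (card W) ^ n)"
proof (cases "U = {}")
  case True
  then show ?thesis by (intro bexI[of _ "{}"]) auto
next
  case False
  then obtain y where y: "y \<in> U" by blast
  interpret product_prob_space "\<lambda>_::nat. uniform_count_measure W" UNIV
    by (intro product_prob_spaceI prob_space_uniform_count_measure W)
  have cyl: "\<exists>A \<in> sets P. C \<subseteq> A \<and> emeasure P A \<le> ennreal (1 / real (card W) ^ n)"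
    if C: "\<And>\<omega>. \<omega> \<in> C \<Longrightarrow> range \<omega> \<subseteq> W" "\<And>\<omega> \<omega>' i. \<lbrakk>\<omega> \<in> C; \<omega>' \<in> C; i < n\<rbrakk> \<Longrightarrow> \<omega> i = \<omega>' i"
    for C
  proof (cases "C = {}")
    case True
    then show ?thesis by (intro bexI[of _ "{}"]) auto
  next
    case False
    then obtain \<omega> where \<omega>: "\<omega> \<in> C" by blast
    define A where "A = {\<eta> \<in> space P. \<forall>i\<in>{..<n}. \<eta> i \<in> {\<omega> i}}"
    have \<omega>W: "\<omega> i \<in> W" for i using C(1)[OF \<omega>] by auto
    have "emeasure P A = (\<Prod>i\<in>{..<n}. emeasure (uniform_count_measure W) {\<omega> i})"
      unfolding A_def P_def using \<omega>W
      by (intro emeasure_PiM_Collect) (auto simp: sets_uniform_count_measure)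
    also have "\<dots> = ennreal (1 / card W) ^ n"
      using \<omega>W W by (simp add: emeasure_uniform_count_measure)
    also have "\<dots> = ennreal (1 / real (card W) ^ n)"
      by (subst ennreal_power) (auto simp: power_one_over)
    finally have eq: "emeasure P A = ennreal (1 / real (card W) ^ n)" .
    have "C \<subseteq> A"
    proof
      fix \<eta> assume \<eta>: "\<eta> \<in> C"
      then have "\<eta> \<in> space P"
        using C(1) by (auto simp: P_def space_PiM space_uniform_count_measure)
      moreover have "\<eta> i = \<omega> i" if "i < n" for i using C(2)[OF \<eta> \<omega> that] .
      ultimately show "\<eta> \<in> A" by (simp add: A_def)
    qed
    moreover have "A \<in> sets P"
    proof -
      have "A = prod_emb UNIV (\<lambda>_. uniform_count_measure W) {..<n} (Pi\<^sub>E {..<n} (\<lambda>i. {\<omega> i}))"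
        by (auto simp: A_def P_def prod_emb_def space_PiM Pi_iff PiE_iff)
      also have "\<dots> \<in> sets P"
        unfolding P_def using \<omega>W by (intro sets_PiM_I) (auto simp: sets_uniform_count_measure)
      finally show ?thesis .
    qed
    ultimately show ?thesis using eq by auto
  qed
  \<comment> \<open>codes whose left endpoint lies in the \<open>z\<close>-th piece; only \<open>z = -2, \<dots>, 1\<close> occur\<close>
  define H where "H z = {\<omega>. range \<omega> \<subseteq> W \<and> x \<omega> \<in> U \<and> \<lfloor>(a n \<omega> - y) / r\<rfloor> = z}" for z :: int
  have "\<exists>A \<in> sets P. H z \<subseteq> A \<and> emeasure P A \<le> ennreal (1 / real (card W) ^ n)" for z
  proof (rule cyl)
    fix \<omega> \<omega>' i assume *: "\<omega> \<in> H z" "\<omega>' \<in> H z" "i < n"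
    show "\<omega> i = \<omega>' i"
    proof (rule ccontr)
      assume "\<omega> i \<noteq> \<omega>' i"
      with * have "r \<le> \<bar>a n \<omega> - a n \<omega>'\<bar>" by (intro sep) (auto simp: H_def)
      then have "1 \<le> \<bar>(a n \<omega> - y) / r - (a n \<omega>' - y) / r\<bar>"
        using \<open>r > 0\<close> by (simp add: field_simps flip: diff_divide_distrib)
      moreover have "\<lfloor>(a n \<omega> - y) / r\<rfloor> = \<lfloor>(a n \<omega>' - y) / r\<rfloor>" using * by (simp add: H_def)
      ultimately show False by linarith
    qed
  qed (auto simp: H_def)
  then obtain A where A: "\<And>z. A z \<in> sets P" "\<And>z. H z \<subseteq> A z"
    "\<And>z. emeasure P (A z) \<le> ennreal (1 / real (card W) ^ n)"
    by metis
  have "{\<omega>. range \<omega> \<subseteq> W \<and> x \<omega> \<in> U} \<subseteq> (\<Union>z\<in>{-2..1}. H z)"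
  proof
    fix \<omega> assume "\<omega> \<in> {\<omega>. range \<omega> \<subseteq> W \<and> x \<omega> \<in> U}"
    then have \<omega>: "range \<omega> \<subseteq> W" "x \<omega> \<in> U" by auto
    have "\<bar>x \<omega> - y\<bar> \<le> r"
      using diameter_bounded_bound[OF U(1) \<omega>(2) y] U(2) by (simp add: dist_real_def)
    with x[OF \<omega>(1)] have "- 2 * r < a n \<omega> - y" "a n \<omega> - y \<le> 1 * r" by auto
    with \<open>r > 0\<close> have "- 2 < (a n \<omega> - y) / r" "(a n \<omega> - y) / r \<le> 1"
      by (auto simp: pos_less_divide_eq pos_divide_le_eq)
    then have "\<lfloor>(a n \<omega> - y) / r\<rfloor> \<in> {-2..1}" by (auto simp: floor_le_iff le_floor_iff)
    with \<omega> show "\<omega> \<in> (\<Union>z\<in>{-2..1}. H z)" by (auto simp: H_def)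
  qed
  also have "\<dots> \<subseteq> (\<Union>z\<in>{-2..1}. A z)" using A(2) by blast
  finally have "{\<omega>. range \<omega> \<subseteq> W \<and> x \<omega> \<in> U} \<subseteq> (\<Union>z\<in>{-2..1}. A z)" .
  moreover have "emeasure P (\<Union>z\<in>{-2..1}. A z) \<le> ennreal (4 / real (card W) ^ n)"
  proof -
    have "emeasure P (\<Union>z\<in>{-2..1}. A z) \<le> (\<Sum>z\<in>{-2..1::int}. emeasure P (A z))"
      using A(1) by (intro emeasure_subadditive_finite) auto
    also have "\<dots> \<le> (\<Sum>z\<in>{-2..1::int}. ennreal (1 / real (card W) ^ n))"
      by (intro sum_mono A)
    also have "\<dots> = ennreal (\<Sum>z\<in>{-2..1::int}. 1 / real (card W) ^ n)"
      by (intro sum_ennreal) auto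
    also have "\<dots> = ennreal (4 / real (card W) ^ n)" by simp
    finally show ?thesis .
  qed
  ultimately show ?thesis
    using A(1) by (intro bexI[of _ "\<Union>z\<in>{-2..1}. A z"]) auto
qed

text \<open>
  The mass distribution principle for a Cantor scheme whose intervals of level \<open>n\<close> are indexed by the
  words of length \<open>n\<close> over \<open>W\<close> and have the common length \<open>\<rho> ^ n * r\<close>. A cover of \<open>E\<close> with small
  sum would cover the whole space of codes by sets whose total probability is less than \<open>1\<close>.
\<close>
lemma hausdorff_measure_pos:
  fixes W :: "'w set" and a :: "nat \<Rightarrow> (nat \<Rightarrow> 'w) \<Rightarrow> real"
    and x :: "(nat \<Rightarrow> 'w) \<Rightarrow> real"
  assumes W: "finite W" "W \<noteq> {}"
    and \<rho>: "0 < \<rho>" "\<rho> < 1" and s: "0 < s" and card: "1 \<le> card W * \<rho> powr s" and "r > 0"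
    and sep: "\<And>n \<omega> \<omega>'. \<lbrakk>range \<omega> \<subseteq> W; range \<omega>' \<subseteq> W; \<exists>i<n. \<omega> i \<noteq> \<omega>' i\<rbrakk>
                \<Longrightarrow> \<rho> ^ n * r \<le> \<bar>a n \<omega> - a n \<omega>'\<bar>"
    and x: "\<And>n \<omega>. range \<omega> \<subseteq> W \<Longrightarrow> a n \<omega> \<le> x \<omega> \<and> x \<omega> < a n \<omega> + \<rho> ^ n * r"
    and E: "\<And>\<omega>. range \<omega> \<subseteq> W \<Longrightarrow> x \<omega> \<in> E"
  shows "hausdorff_measure s E \<noteq> 0"
proof
  assume 0: "hausdorff_measure s E = 0"
  define P where "P = PiM UNIV (\<lambda>_::nat. uniform_count_measure W)"
  interpret product_prob_space "\<lambda>_::nat. uniform_count_measure W" UNIV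
    by (intro product_prob_spaceI prob_space_uniform_count_measure W)
  define q where "q = real (card W)"
  have q: "0 < q" "1 \<le> q * \<rho> powr s" using W card by (auto simp: q_def card_gt_0_iff)
  have lim: "(\<lambda>n. (\<rho> powr s) ^ n) \<longlonglongrightarrow> 0"
    using \<rho> s powr_less_mono2[of s \<rho> 1] by (intro LIMSEQ_realpow_zero) auto
  have inv_q: "1 / q ^ n \<le> (\<rho> powr s) ^ n" for n
  proof -
    have "1 \<le> (q * \<rho> powr s) ^ n" using q by (intro one_le_power) auto
    then show ?thesis using q by (simp add: field_simps power_mult_distrib)
  qed
  have cover: "\<exists>A \<in> sets P. {\<omega>. range \<omega> \<subseteq> W \<and> x \<omega> \<in> U} \<subseteq> A
      \<and> emeasure P A \<le> ennreal (4 * (\<rho> powr s) ^ n)"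
    if U: "bounded U" "diameter U \<le> \<rho> ^ n * r" for U n
  proof -
    have "\<exists>A \<in> sets P. {\<omega>. range \<omega> \<subseteq> W \<and> x \<omega> \<in> U} \<subseteq> A
      \<and> emeasure P A \<le> ennreal (4 / real (card W) ^ n)"
      unfolding P_def
    proof (rule mass_distribution_cover[where a = a and r = "\<rho> ^ n * r"])
      show "0 < \<rho> ^ n * r" using \<rho> \<open>r > 0\<close> by simp
    qed (fact W U sep x)+
    then obtain A where A: "A \<in> sets P" "{\<omega>. range \<omega> \<subseteq> W \<and> x \<omega> \<in> U} \<subseteq> A"
      "emeasure P A \<le> ennreal (4 / real (card W) ^ n)" by (elim bexE conjE)
    have "ennreal (4 / real (card W) ^ n) \<le> ennreal (4 * (\<rho> powr s) ^ n)"
      using inv_q[of n] by (intro ennreal_leI) (simp add: q_def)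
    from order_trans[OF A(3) this] A(1,2) show ?thesis by (intro bexI[of _ A] conjI)
  qed
  \<comment> \<open>level \<open>n\<close> is used for \<open>\<rho> ^ Suc n * r < diameter U\<close>, which costs the factor \<open>(\<rho> * r) powr s\<close>\<close>
  define K where "K = 4 / (\<rho> * r) powr s"
  have "\<rho> * r > 0" using \<rho> \<open>r > 0\<close> by simp
  then have "0 < (\<rho> * r) powr s" unfolding powr_gt_zero by (rule less_imp_neq[symmetric])
  then have "K > 0" unfolding K_def by (rule divide_pos_pos[OF zero_less_numeral])
  have mass: "\<exists>A \<in> sets P. {\<omega>. range \<omega> \<subseteq> W \<and> x \<omega> \<in> U} \<subseteq> A
      \<and> emeasure P A \<le> ennreal K * diam_powr s U"
    if U: "bounded U" "diameter U \<le> r" for U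
  proof -
    consider "U = {}" | "U \<noteq> {}" "diameter U = 0" | "U \<noteq> {}" "diameter U > 0"
      using diameter_ge_0[OF U(1)] by force
    then show ?thesis
    proof cases
      case 1
      then show ?thesis by (intro bexI[of _ "{}"]) auto
    next
      \<comment> \<open>a single point: it has mass at most \<open>4 * (\<rho> powr s) ^ n\<close> for every \<open>n\<close>\<close>
      case 2
      then have small: "diameter U \<le> \<rho> ^ n * r" for n using \<rho> \<open>r > 0\<close> by simp
      have "\<forall>n. \<exists>A. A \<in> sets P \<and> {\<omega>. range \<omega> \<subseteq> W \<and> x \<omega> \<in> U} \<subseteq> A
          \<and> emeasure P A \<le> ennreal (4 * (\<rho> powr s) ^ n)"
        using cover[OF U(1) small] unfolding Bex_def by (intro allI)
      from choice[OF this] obtain A where A: "A n \<in> sets P"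
        "{\<omega>. range \<omega> \<subseteq> W \<and> x \<omega> \<in> U} \<subseteq> A n"
        "emeasure P (A n) \<le> ennreal (4 * (\<rho> powr s) ^ n)" for n
        by (elim exE) blast
      have "emeasure P (\<Inter>n. A n) \<le> ennreal (4 * (\<rho> powr s) ^ n)" for n
      proof -
        have "emeasure P (\<Inter>n. A n) \<le> emeasure P (A n)" using A(1) by (intro emeasure_mono) auto
        with A(3) show ?thesis by (rule order_trans[rotated])
      qed
      moreover have "(\<lambda>n. ennreal (4 * (\<rho> powr s) ^ n)) \<longlonglongrightarrow> ennreal (4 * 0)"
        by (intro tendsto_ennrealI tendsto_intros lim)
      ultimately have "emeasure P (\<Inter>n. A n) \<le> ennreal (4 * 0)"
        by (intro tendsto_lowerbound[of _ _ sequentially]) auto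
      moreover have "(\<Inter>n. A n) \<in> sets P" using A(1) by (intro sets.countable_INT) auto
      moreover have "{\<omega>. range \<omega> \<subseteq> W \<and> x \<omega> \<in> U} \<subseteq> (\<Inter>n. A n)" using A(2) by (rule INT_greatest)
      ultimately show ?thesis by (intro bexI[of _ "\<Inter>n. A n"]) simp_all
    next
      case 3
      define d where "d = diameter U"
      have d: "0 < d" "d \<le> r" using 3 U by (auto simp: d_def)
      have "(\<lambda>n. \<rho> ^ n * r) \<longlonglongrightarrow> 0 * r"
        using \<rho> by (intro tendsto_intros LIMSEQ_realpow_zero) auto
      then have "eventually (\<lambda>n. \<rho> ^ n * r < d) sequentially"
        using d by (intro order_tendstoD(2)) auto
      then obtain m where "\<rho> ^ m * r < d" by (auto simp: eventually_sequentially)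
      define m where "m = (LEAST m. \<rho> ^ m * r < d)"
      have m: "\<rho> ^ m * r < d" unfolding m_def by (rule LeastI) fact
      with d have "m \<noteq> 0" by (cases m) auto
      then obtain n where n: "m = Suc n" by (cases m) auto
      have "\<not> \<rho> ^ n * r < d" using not_less_Least[of n "\<lambda>m. \<rho> ^ m * r < d"] n by (simp add: m_def)
      then have "diameter U \<le> \<rho> ^ n * r" by (simp add: d_def)
      from cover[OF U(1) this]
      obtain A where A: "A \<in> sets P" "{\<omega>. range \<omega> \<subseteq> W \<and> x \<omega> \<in> U} \<subseteq> A"
        "emeasure P A \<le> ennreal (4 * (\<rho> powr s) ^ n)"
        by (elim bexE conjE)
      have "4 * (\<rho> powr s) ^ n = K * (\<rho> ^ m * r) powr s"
      proof -
        have "(\<rho> ^ m * r) powr s = (\<rho> ^ n * (\<rho> * r)) powr s" by (simp add: n mult_ac)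
        also have "\<dots> = (\<rho> ^ n) powr s * (\<rho> * r) powr s"
          using \<rho> \<open>r > 0\<close> by (intro powr_mult) 
        also have "(\<rho> ^ n) powr s = (\<rho> powr s) ^ n"
          using \<rho> by (induction n) (simp_all add: powr_mult)
        finally show ?thesis using \<rho> \<open>r > 0\<close> by (simp add: K_def)
      qed
      also have "\<dots> \<le> K * d powr s"
        using m \<rho> \<open>r > 0\<close> \<open>K > 0\<close> s by (intro mult_left_mono powr_mono2) auto
      finally have "ennreal (4 * (\<rho> powr s) ^ n) \<le> ennreal (K * d powr s)"
        by (rule ennreal_leI)
      also have "\<dots> = ennreal K * diam_powr s U"
        using 3 s \<open>K > 0\<close> by (simp add: diam_powr_def d_def ennreal_mult)
      finally have "ennreal (4 * (\<rho> powr s) ^ n) \<le> ennreal K * diam_powr s U" .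
      from order_trans[OF A(3) this] A(1,2) show ?thesis by (intro bexI[of _ A] conjI)
    qed
  qed
  have "hausdorff_premeasure s r E \<le> hausdorff_measure s E"
    unfolding hausdorff_measure_def using \<open>r > 0\<close> by (intro SUP_upper) auto
  then have "hausdorff_premeasure s r E < ennreal (1 / (2 * K))" using 0 \<open>K > 0\<close> by simp
  then obtain U where "U \<in> {U. (\<forall>i. bounded (U i) \<and> diameter (U i) \<le> r) \<and> E \<subseteq> (\<Union>i. U i)}"
    and lt: "(\<Sum>i. diam_powr s (U i)) < ennreal (1 / (2 * K))"
    unfolding hausdorff_premeasure_def INF_less_iff by (elim bexE)
  then have U: "bounded (U i)" "diameter (U i) \<le> r" "E \<subseteq> (\<Union>i. U i)" for i by simp_all
  have "\<forall>i. \<exists>A. A \<in> sets P \<and> {\<omega>. range \<omega> \<subseteq> W \<and> x \<omega> \<in> U i} \<subseteq> A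
      \<and> emeasure P A \<le> ennreal K * diam_powr s (U i)"
    using mass[OF U(1,2)] unfolding Bex_def by (intro allI)
  from choice[OF this] obtain A where A: "A i \<in> sets P"
      "{\<omega>. range \<omega> \<subseteq> W \<and> x \<omega> \<in> U i} \<subseteq> A i"
      "emeasure P (A i) \<le> ennreal K * diam_powr s (U i)" for i
    by (elim exE) blast
  have "space P \<subseteq> (\<Union>i. A i)"
  proof
    fix \<omega> assume "\<omega> \<in> space P"
    then have "range \<omega> \<subseteq> W" by (auto simp: P_def space_PiM space_uniform_count_measure PiE_def)
    moreover from E[OF this] obtain i where "x \<omega> \<in> U i" using U(3) by blast
    ultimately show "\<omega> \<in> (\<Union>i. A i)" using A(2) by blast
  qed
  moreover have "(\<Union>i. A i) \<in> sets P" using A(1) by (intro sets.countable_UN) auto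
  ultimately have "emeasure P (space P) \<le> emeasure P (\<Union>i. A i)" by (rule emeasure_mono)
  moreover have "emeasure P (space P) = 1" unfolding P_def by (rule emeasure_space_1)
  ultimately have "1 \<le> emeasure P (\<Union>i. A i)" by simp
  also have "\<dots> \<le> (\<Sum>i. emeasure P (A i))"
    by (intro emeasure_subadditive_countably image_subsetI A(1))
  also have "\<dots> \<le> (\<Sum>i. ennreal K * diam_powr s (U i))"
    by (intro suminf_le A) auto
  also have "\<dots> = ennreal K * (\<Sum>i. diam_powr s (U i))" by (rule ennreal_suminf_cmult)
  also have "\<dots> \<le> ennreal K * ennreal (1 / (2 * K))"
    using lt by (intro mult_left_mono) auto
  also have "\<dots> = ennreal (1 / 2)" using \<open>K > 0\<close> by (subst ennreal_mult[symmetric]) auto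
  also have "\<dots> < ennreal 1" by (intro ennreal_lessI) auto
  finally show False by simp
qed

section \<open>Random-walk words with positive drift\<close>

definition jump_ratio :: "int \<Rightarrow> real" where
  "jump_ratio l = 3 / (pi\<^sup>2 * (real_of_int l)\<^sup>2)"

lemma jump_ratio_pos: "l \<noteq> 0 \<Longrightarrow> 0 < jump_ratio l"
  by (simp add: jump_ratio_def)

lemma jump_ratio_minus: "jump_ratio (- l) = jump_ratio l"
  by (simp add: jump_ratio_def)

lemma jump_ratio_less_1: "l \<noteq> 0 \<Longrightarrow> jump_ratio l < 1"
proof -
  assume "l \<noteq> 0"
  then have "1 \<le> (real_of_int l)\<^sup>2"
    using one_le_power[of "\<bar>real_of_int l\<bar>" 2] by simp
  moreover have "3 * 3 < pi\<^sup>2" unfolding power2_eq_square using pi_gt3 by (intro mult_strict_mono) auto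
  ultimately have "3 < pi\<^sup>2 * (real_of_int l)\<^sup>2"
    using mult_mono[of 9 "pi\<^sup>2" 1 "(real_of_int l)\<^sup>2"] by simp
  then show ?thesis by (simp add: jump_ratio_def)
qed

text \<open>
  The full sum of the ratios is \<open>1\<close>. Raising to the power \<open>s < 1\<close> increases every term, and the
  gain \<open>\<epsilon>\<close> at \<open>l = 1\<close> alone already outweighs the tail lost by truncation.
\<close>
lemma exists_large_jump_sum:
  assumes s: "0 < s" "s < 1"
  shows "\<exists>M::int. M \<ge> 1 \<and> 1 < (\<Sum>l\<in>{-M..M} - {0}. jump_ratio l powr s)"
proof -
  let ?p = "\<lambda>n::nat. jump_ratio (int (Suc n))"
  have "(\<lambda>n. 3 / pi\<^sup>2 * (1 / (real n + 1)\<^sup>2)) sums (3 / pi\<^sup>2 * (pi\<^sup>2 / 6))"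
    using inverse_squares_sums by (intro sums_mult) (simp add: add.commute)
  then have "?p sums (1 / 2)"
    by (simp add: jump_ratio_def add.commute)
  then have lim: "(\<lambda>n. \<Sum>i<n. ?p i) \<longlonglongrightarrow> 1 / 2" by (simp add: sums_def)
  define \<epsilon> where "\<epsilon> = jump_ratio 1 powr s - jump_ratio 1"
  have p1: "0 < jump_ratio 1" "jump_ratio 1 < 1" by (simp_all add: jump_ratio_pos jump_ratio_less_1)
  have "jump_ratio 1 powr 1 < jump_ratio 1 powr s" using p1 s by (intro powr_less_mono') auto
  then have "\<epsilon> > 0" using p1 by (simp add: \<epsilon>_def)
  then have "eventually (\<lambda>n. 1 / 2 - \<epsilon> < (\<Sum>i<n. ?p i)) sequentially"
    using lim by (intro order_tendstoD(1)) auto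
  then obtain n0 where "\<forall>n\<ge>n0. 1 / 2 - \<epsilon> < (\<Sum>i<n. ?p i)"
    unfolding eventually_sequentially by blast
  then have "1 / 2 - \<epsilon> < (\<Sum>i<Suc n0. ?p i)" by (meson le_SucI order_refl)
  then obtain n where n: "n > 0" "1 / 2 - \<epsilon> < (\<Sum>i<n. ?p i)" by blast
  have ge: "?p i \<le> ?p i powr s" for i
    using powr_mono'[of s 1 "?p i"] jump_ratio_pos[of "int (Suc i)"] jump_ratio_less_1[of "int (Suc i)"] s
    by simp
  have "(\<Sum>i<n. ?p i) + \<epsilon> \<le> (\<Sum>i<n. ?p i powr s)"
  proof -
    obtain m where m: "n = Suc m" using n by (cases n) auto
    have "(\<Sum>i<n. ?p i) + \<epsilon> = jump_ratio 1 powr s + (\<Sum>i<m. ?p (Suc i))"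
      unfolding m sum.lessThan_Suc_shift by (simp add: \<epsilon>_def)
    also have "\<dots> \<le> jump_ratio 1 powr s + (\<Sum>i<m. ?p (Suc i) powr s)"
      by (intro add_left_mono sum_mono ge)
    also have "\<dots> = (\<Sum>i<n. ?p i powr s)"
      unfolding m sum.lessThan_Suc_shift by simp
    finally show ?thesis .
  qed
  with n have half: "1 / 2 < (\<Sum>i<n. ?p i powr s)" by simp
  have pos: "(\<Sum>l\<in>{1..int n}. jump_ratio l powr s) = (\<Sum>i<n. ?p i powr s)"
    by (rule sum.reindex_bij_witness[of _ "\<lambda>i. int (Suc i)" "\<lambda>l. nat (l - 1)"]) auto
  have neg: "(\<Sum>l\<in>{-int n..-1}. jump_ratio l powr s) = (\<Sum>l\<in>{1..int n}. jump_ratio l powr s)"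
    by (rule sum.reindex_bij_witness[of _ uminus uminus]) (auto simp: jump_ratio_minus)
  have "{-int n..int n} - {0} = {-int n..-1} \<union> {1..int n}" by auto
  then have "(\<Sum>l\<in>{-int n..int n} - {0}. jump_ratio l powr s)
      = (\<Sum>l\<in>{-int n..-1}. jump_ratio l powr s) + (\<Sum>l\<in>{1..int n}. jump_ratio l powr s)"
    by (simp add: sum.union_disjoint)
  with pos neg half n show ?thesis by (intro exI[of _ "int n"]) auto
qed

lemma sum_prod_list_length:
  fixes f :: "'a \<Rightarrow> real"
  assumes "finite D"
  shows "(\<Sum>w | set w \<subseteq> D \<and> length w = n. prod_list (map f w)) = (\<Sum>l\<in>D. f l) ^ n"
proof (induction n)
  case 0
  have "{w. set w \<subseteq> D \<and> length w = 0} = {[]}" by auto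
  then show ?case by simp
next
  case (Suc n)
  let ?X = "{w. set w \<subseteq> D \<and> length w = n}"
  have "(\<Sum>w | set w \<subseteq> D \<and> length w = Suc n. prod_list (map f w))
      = (\<Sum>(l, w)\<in>D \<times> ?X. f l * prod_list (map f w))"
    by (rule sum.reindex_bij_witness[of _ "\<lambda>(l, w). l # w" "\<lambda>w. (hd w, tl w)"])
       (auto simp: length_Suc_conv)
  also have "\<dots> = (\<Sum>l\<in>D. f l) * (\<Sum>w\<in>?X. prod_list (map f w))"
    by (simp add: sum_product sum.cartesian_product)
  finally show ?case using Suc by simp
qed

text \<open>
  For an even weight, the product over a word depends only on how often each absolute value occurs. This is
  why there are only polynomially many products.
\<close>
lemma prod_list_eq_prod_count_abs:
  fixes f :: "int \<Rightarrow> real"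
  assumes "\<And>l. f (- l) = f l" "set w \<subseteq> {-M..M} - {0}"
  shows "prod_list (map f w) = (\<Prod>l\<in>{1..M}. f l ^ count_list (map abs w) l)"
  using assms(2)
proof (induction w)
  case (Cons k w)
  have k: "\<bar>k\<bar> \<in> {1..M}" using Cons.prems by auto
  have "f \<bar>k\<bar> = f k" using assms(1) by (cases "k \<ge> 0") auto
  moreover have "(\<Prod>l\<in>{1..M}. f l ^ count_list (map abs (k # w)) l)
      = (\<Prod>l\<in>{1..M}. (if l = \<bar>k\<bar> then f l else 1) * f l ^ count_list (map abs w) l)"
    by (intro prod.cong) auto
  moreover have "\<dots> = (\<Prod>l\<in>{1..M}. if l = \<bar>k\<bar> then f l else 1) * prod_list (map f w)"
    using Cons by (simp add: prod.distrib)
  moreover have "(\<Prod>l\<in>{1..M}. if l = \<bar>k\<bar> then f l else 1) = f \<bar>k\<bar>"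
    using k by (simp add: prod.delta)
  ultimately show ?case by simp
qed simp

lemma card_prod_list_values:
  fixes f :: "int \<Rightarrow> real"
  assumes "\<And>l. f (- l) = f l"
  shows "card ((\<lambda>w. prod_list (map f w)) ` {w. set w \<subseteq> {-M..M} - {0} \<and> length w = n})
           \<le> (n + 1) ^ nat M" (is "card (?g ` ?X) \<le> _")
proof -
  let ?F = "PiE {1..M} (\<lambda>_. {0..n})"
  have "?g ` ?X \<subseteq> (\<lambda>c. \<Prod>l\<in>{1..M}. f l ^ c l) ` ?F"
  proof
    fix y assume "y \<in> ?g ` ?X"
    then obtain w where w: "w \<in> ?X" "y = ?g w" by blast
    define c where "c = restrict (count_list (map abs w)) {1..M}"
    have "c \<in> ?F" using w count_le_length[of "map abs w"] by (auto simp: c_def)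
    moreover have "y = (\<Prod>l\<in>{1..M}. f l ^ c l)"
      using w prod_list_eq_prod_count_abs[of f w M] assms by (simp add: c_def)
    ultimately show "y \<in> (\<lambda>c. \<Prod>l\<in>{1..M}. f l ^ c l) ` ?F" by blast
  qed
  then have "card (?g ` ?X) \<le> card ((\<lambda>c. \<Prod>l\<in>{1..M}. f l ^ c l) ` ?F)"
    by (intro card_mono) (auto intro: finite_PiE)
  also have "\<dots> \<le> card ?F" by (intro card_image_le finite_PiE) auto
  also have "\<dots> = (n + 1) ^ nat M" by (simp add: card_PiE)
  finally show ?thesis .
qed

text \<open>
  Pigeonhole: the total weight \<open>S\<^sup>n\<close> of all words of length \<open>n\<close> is distributed over at most
  \<open>(n + 1)\<^sup>M\<close> ratios; \<open>\<rho>\<close> is one that carries the largest share.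
\<close>
lemma exists_common_ratio:
  fixes s :: real
  assumes "M \<ge> 1"
  shows "\<exists>\<rho>. 0 < \<rho> \<and> (\<exists>w. set w \<subseteq> {-M..M} - {0} \<and> length w = n \<and> prod_list (map jump_ratio w) = \<rho>) \<and>
     (\<Sum>l\<in>{-M..M} - {0}. jump_ratio l powr s) ^ n \<le> (real n + 1) ^ nat M *
     (card {w. set w \<subseteq> {-M..M} - {0} \<and> length w = n \<and> prod_list (map jump_ratio w) = \<rho>} * \<rho> powr s)"
proof -
  let ?D = "{-M..M} - {0}"
  let ?X = "{w. set w \<subseteq> ?D \<and> length w = n}"
  let ?g = "\<lambda>w. prod_list (map jump_ratio w)"
  let ?h = "\<lambda>\<rho>. card {w\<in>?X. ?g w = \<rho>} * \<rho> powr s"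
  have fin: "finite ?X" by (rule finite_lists_length_eq) auto
  have pos: "0 < ?g w" if "w \<in> ?X" for w
    using that by (induction w arbitrary: n) (auto intro!: mult_pos_pos jump_ratio_pos)
  have pw: "prod_list (map (\<lambda>l. jump_ratio l powr s) w) = ?g w powr s" if "set w \<subseteq> ?D" for w
    using that
  proof (induction w)
    case (Cons k w)
    have "0 \<le> jump_ratio k" by (simp add: jump_ratio_def)
    moreover have "0 \<le> ?g w" by (intro prod_list_nonneg) (auto simp: jump_ratio_def)
    ultimately show ?case using Cons by (simp add: powr_mult)
  qed simp
  have "replicate n 1 \<in> ?X" using assms by auto
  then have ne: "?X \<noteq> {}" by blast
  have hfin: "finite (?h ` ?g ` ?X)" "?h ` ?g ` ?X \<noteq> {}" using fin ne by simp_all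
  obtain \<rho> where \<rho>: "\<rho> \<in> ?g ` ?X" "?h \<rho> = Max (?h ` ?g ` ?X)"
    using Max_in[OF hfin] by (metis (no_types, lifting) imageE)
  have max: "?h y \<le> ?h \<rho>" if "y \<in> ?g ` ?X" for y
    unfolding \<rho>(2) using hfin(1) that by (intro Max_ge imageI)
  have "(\<Sum>l\<in>?D. jump_ratio l powr s) ^ n = (\<Sum>w\<in>?X. prod_list (map (\<lambda>l. jump_ratio l powr s) w))"
    by (rule sum_prod_list_length[symmetric]) auto
  also have "\<dots> = (\<Sum>w\<in>?X. ?g w powr s)" by (intro sum.cong pw) auto
  also have "\<dots> = (\<Sum>y\<in>?g ` ?X. \<Sum>w\<in>{w\<in>?X. ?g w = y}. ?g w powr s)"
    by (rule sum.image_gen[OF fin])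
  also have "\<dots> = (\<Sum>y\<in>?g ` ?X. ?h y)" by (intro sum.cong) auto
  also have "\<dots> \<le> real (card (?g ` ?X)) * ?h \<rho>"
    by (rule sum_bounded_above) (rule max)
  also have "\<dots> \<le> real ((n + 1) ^ nat M) * ?h \<rho>"
    by (intro mult_right_mono of_nat_mono card_prod_list_values) (auto simp: jump_ratio_minus)
  finally have "(\<Sum>l\<in>?D. jump_ratio l powr s) ^ n \<le> (real n + 1) ^ nat M * ?h \<rho>"
    by (simp add: add.commute)
  moreover have "{w\<in>?X. ?g w = \<rho>} = {w. set w \<subseteq> ?D \<and> length w = n \<and> ?g w = \<rho>}" by auto
  ultimately show ?thesis using \<rho>(1) pos by (intro exI[of _ \<rho>]) auto
qed

lemma card_le_twice_nonneg_sum: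
  fixes X :: "int list set"
  assumes "finite X" "\<And>w. w \<in> X \<Longrightarrow> map uminus w \<in> X"
  shows "card X \<le> 2 * card {w\<in>X. sum_list w \<ge> 0}"
proof -
  let ?Y = "{w\<in>X. sum_list w \<ge> 0}"
  have neg: "sum_list (map uminus w) = - sum_list w" for w :: "int list"
    by (induction w) auto
  have "X \<subseteq> ?Y \<union> map uminus ` ?Y"
  proof
    fix w assume w: "w \<in> X"
    show "w \<in> ?Y \<union> map uminus ` ?Y"
    proof (cases "sum_list w \<ge> 0")
      case False
      then have "map uminus w \<in> ?Y" using w assms(2) by (simp add: neg)
      moreover have "w = map uminus (map uminus w)" by (simp add: comp_def)
      ultimately show ?thesis by blast
    qed (use w in auto)
  qed
  then have "card X \<le> card (?Y \<union> map uminus ` ?Y)"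
    using assms(1) by (intro card_mono) auto
  also have "\<dots> \<le> card ?Y + card (map uminus ` ?Y)" by (rule card_Un_le)
  also have "\<dots> \<le> card ?Y + card ?Y" using assms(1) by (intro add_left_mono card_image_le) auto
  finally show ?thesis by simp
qed

lemma polynomial_over_power_tendsto_0:
  fixes S :: real
  assumes "S > 1"
  shows "(\<lambda>n. (real n + 1) ^ k / S ^ n) \<longlonglongrightarrow> 0"
proof -
  \<comment> \<open>a root turns the polynomial factor into a power of \<open>n / x\<^sup>n\<close>, up to a shift of \<open>n\<close>\<close>
  define x where "x = root (Suc k) S"
  have "x > 1" using assms by (simp add: x_def)
  have xS: "x ^ Suc k = S" unfolding x_def using assms by (intro real_root_pow_pos2) auto
  have "(\<lambda>n. real n / x ^ n) \<longlonglongrightarrow> 0" using \<open>x > 1\<close> by (intro lim_n_over_pown) auto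
  then have "(\<lambda>n. S * (real (Suc n) / x ^ Suc n) ^ Suc k) \<longlonglongrightarrow> S * 0 ^ Suc k"
    by (intro tendsto_intros LIMSEQ_Suc)
  then have lim: "(\<lambda>n. S * (real (Suc n) / x ^ Suc n) ^ Suc k) \<longlonglongrightarrow> 0" by simp
  have upper: "(real n + 1) ^ k / S ^ n \<le> S * (real (Suc n) / x ^ Suc n) ^ Suc k" for n
  proof -
    have "(x ^ Suc n) ^ Suc k = S ^ Suc n" by (simp only: xS[symmetric] power_mult[symmetric] mult.commute)
    then have "S * (real (Suc n) / x ^ Suc n) ^ Suc k = S * (real (Suc n) ^ Suc k / S ^ Suc n)"
      unfolding power_divide by (rule arg_cong)
    also have "\<dots> = real (Suc n) ^ Suc k / S ^ n" using assms by simp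
    finally have "S * (real (Suc n) / x ^ Suc n) ^ Suc k = real (Suc n) ^ Suc k / S ^ n" .
    moreover have "(real n + 1) ^ k \<le> real (Suc n) ^ Suc k"
      using power_increasing[of k "Suc k" "real (Suc n)"] by (simp add: add.commute)
    ultimately show ?thesis using assms by (simp only: divide_right_mono zero_le_power)
  qed
  show ?thesis
  proof (rule tendsto_sandwich[OF _ _ tendsto_const lim])
    show "\<forall>\<^sub>F n in sequentially. 0 \<le> (real n + 1) ^ k / S ^ n"
      using assms by (intro always_eventually allI divide_nonneg_nonneg zero_le_power) simp_all
    show "\<forall>\<^sub>F n in sequentially. (real n + 1) ^ k / S ^ n \<le> S * (real (Suc n) / x ^ Suc n) ^ Suc k"
      by (rule always_eventually) (intro allI upper)
  qed
qed

text \<open>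
  The alphabet of the Cantor scheme. The exponential surplus of \<open>S > 1\<close> absorbs the polynomial number
  of ratios, the factor \<open>2\<close> lost to words of negative sum, and the cost of one upward jump.
\<close>
lemma exists_word_set:
  assumes s: "0 < s" "s < 1"
  shows "\<exists>(W :: int list set) (L::nat) (M::int) \<rho>. finite W \<and> W \<noteq> {} \<and> 0 < L \<and> 0 < \<rho> \<and> \<rho> < 1 \<and>
    1 \<le> real (card W) * \<rho> powr s \<and>
    (\<forall>w\<in>W. length w = L \<and> set w \<subseteq> {-M..M} - {0} \<and> 1 \<le> sum_list w \<and> prod_list (map jump_ratio w) = \<rho>)"
proof -
  obtain M :: int where M: "M \<ge> 1" "1 < (\<Sum>l\<in>{-M..M} - {0}. jump_ratio l powr s)"
    using exists_large_jump_sum[OF s] by blast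
  define S where "S = (\<Sum>l\<in>{-M..M} - {0}. jump_ratio l powr s)"
  define p where "p = jump_ratio 1"
  have p: "0 < p" "p < 1" by (simp_all add: p_def jump_ratio_pos jump_ratio_less_1)
  have "S > 1" using M by (simp add: S_def)
  then have "(\<lambda>n. (real n + 1) ^ nat M / S ^ n) \<longlonglongrightarrow> 0"
    by (rule polynomial_over_power_tendsto_0)
  then have "eventually (\<lambda>n. (real n + 1) ^ nat M / S ^ n < p powr s / 2) sequentially"
    using p by (intro order_tendstoD(2)) auto
  then obtain n where n: "(real n + 1) ^ nat M / S ^ n < p powr s / 2"
    by (auto simp: eventually_sequentially)
  obtain \<rho> where \<rho>: "0 < \<rho>" and
    w0: "\<exists>w. set w \<subseteq> {-M..M} - {0} \<and> length w = n \<and> prod_list (map jump_ratio w) = \<rho>" and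
    big: "S ^ n \<le> (real n + 1) ^ nat M *
     (card {w. set w \<subseteq> {-M..M} - {0} \<and> length w = n \<and> prod_list (map jump_ratio w) = \<rho>} * \<rho> powr s)"
    using exists_common_ratio[OF M(1), where s = s and n = n] unfolding S_def by blast
  define X where "X = {w. set w \<subseteq> {-M..M} - {0} \<and> length w = n \<and> prod_list (map jump_ratio w) = \<rho>}"
  have finX: "finite X"
    by (rule finite_subset[OF _ finite_lists_length_eq[of "{-M..M} - {0}" n]]) (auto simp: X_def)
  define Y where "Y = {w\<in>X. sum_list w \<ge> 0}"
  have "map uminus w \<in> X" if "w \<in> X" for w
    using that by (auto simp: X_def comp_def jump_ratio_minus)
  then have cXY: "card X \<le> 2 * card Y"
    unfolding Y_def by (intro card_le_twice_nonneg_sum finX)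
  \<comment> \<open>the final jump \<open>+1\<close> gives a positive sum at the cost of a factor \<open>p\<close>, compensated by the size of \<open>n\<close>\<close>
  define W where "W = (\<lambda>w. w @ [1]) ` Y"
  have cW: "card W = card Y" unfolding W_def by (rule card_image) (auto simp: inj_on_def)
  have "1 < p powr s / 2 * (S ^ n / (real n + 1) ^ nat M)"
    using n \<open>S > 1\<close> by (simp add: field_simps)
  also have "\<dots> \<le> p powr s / 2 * (card X * \<rho> powr s)"
    using big by (intro mult_left_mono) (auto simp: X_def divide_le_eq mult_ac)
  also have "\<dots> \<le> p powr s / 2 * (2 * card Y * \<rho> powr s)"
    using cXY by (intro mult_left_mono mult_right_mono) (auto simp: of_nat_le_iff[of "card X", symmetric] simp del: of_nat_le_iff)
  also have "\<dots> = card W * (\<rho> * p) powr s"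
    using \<rho> p by (simp add: cW powr_mult)
  finally have large: "1 \<le> card W * (\<rho> * p) powr s" by simp
  have "\<rho> \<le> 1"
  proof -
    obtain w where w: "set w \<subseteq> {-M..M} - {0}" "prod_list (map jump_ratio w) = \<rho>" using w0 by blast
    have "prod_list (map jump_ratio w) \<le> 1" using w(1)
    proof (induction w)
      case (Cons k w)
      then show ?case using jump_ratio_less_1[of k] jump_ratio_pos[of k]
        by (auto intro!: mult_le_one prod_list_nonneg simp: jump_ratio_def)
    qed simp
    with w show ?thesis by simp
  qed
  then have "\<rho> * p \<le> 1 * p" using p by (intro mult_right_mono) auto
  with p have lt1: "\<rho> * p < 1" by linarith
  have "W \<noteq> {}" using large by auto
  moreover have "finite W" using finX by (simp add: W_def Y_def)
  moreover have "\<forall>w\<in>W. length w = Suc n \<and> set w \<subseteq> {-M..M} - {0} \<and> 1 \<le> sum_list w \<and> prod_list (map jump_ratio w) = \<rho> * p"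
    using M(1) by (auto simp: W_def Y_def X_def p_def)
  ultimately show ?thesis using large lt1 \<rho> p
    by (intro exI[of _ W] exI[of _ "Suc n"] exI[of _ M] exI[of _ "\<rho> * p"]) auto
qed

section \<open>Geometry of the construction\<close>

definition inv_squares :: "nat \<Rightarrow> real" where
  "inv_squares l = (\<Sum>j = 1..l. 1 / (real j)\<^sup>2)"

lemma inv_squares_Suc: "inv_squares (Suc l) = inv_squares l + 1 / (real (Suc l))\<^sup>2"
  by (simp add: inv_squares_def)

lemma inv_squares_mono: "l \<le> m \<Longrightarrow> inv_squares l \<le> inv_squares m"
  unfolding inv_squares_def by (intro sum_mono2) auto

lemma inv_squares_nonneg: "0 \<le> inv_squares l"
  unfolding inv_squares_def by (intro sum_nonneg) auto

lemma inv_squares_less: "inv_squares l < pi\<^sup>2 / 6"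
proof -
  have "inv_squares (Suc l) = (\<Sum>n<Suc l. 1 / (real (n + 1))\<^sup>2)"
    unfolding inv_squares_def
    by (rule sum.reindex_bij_witness[of _ Suc "\<lambda>j. j - 1"]) auto
  also have "\<dots> \<le> (\<Sum>n. 1 / (real (n + 1))\<^sup>2)"
    using inverse_squares_sums by (intro sum_le_suminf) (auto simp: sums_iff)
  also have "\<dots> = pi\<^sup>2 / 6" using inverse_squares_sums by (simp add: sums_iff)
  finally have "inv_squares (Suc l) \<le> pi\<^sup>2 / 6" .
  moreover have "0 < 1 / (real (Suc l))\<^sup>2" by simp
  ultimately show ?thesis unfolding inv_squares_Suc by linarith
qed

lemma sum_lessThan_inv_squares: "(\<Sum>j = 1..<l. 1 / (real j)\<^sup>2) = inv_squares (l - 1)"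
proof -
  have "{1..<l} = {1..l - 1}" by auto
  then show ?thesis by (simp add: inv_squares_def)
qed

lemma inv_squares_step: "l \<ge> 1 \<Longrightarrow> inv_squares l = inv_squares (l - 1) + 1 / (real l)\<^sup>2"
  by (cases l) (auto simp: inv_squares_Suc)

lemma child_up:
  assumes "k < m"
  shows "child k (a, b) m = (a + 3 * (b - a) / pi\<^sup>2 * inv_squares (m - k - 1),
                             a + 3 * (b - a) / pi\<^sup>2 * inv_squares (m - k))"
  using assms by (simp add: child_def Let_def sum_lessThan_inv_squares del: One_nat_def flip: inv_squares_def)

lemma child_down:
  assumes "m < k"
  shows "child k (a, b) m =
    (b - 3 * (b - a) / pi\<^sup>2 * (1 / (2 * real k)\<^sup>2 + inv_squares (k - m)),
     b - 3 * (b - a) / pi\<^sup>2 * (1 / (2 * real k)\<^sup>2 + inv_squares (k - m - 1)))"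
  using assms by (simp add: child_def Let_def sum_lessThan_inv_squares del: One_nat_def flip: inv_squares_def)

lemma length_child:
  assumes "m \<noteq> k"
  shows "snd (child k (a, b) m) - fst (child k (a, b) m) = jump_ratio (int m - int k) * (b - a)"
proof (cases "k < m")
  case True
  then have "inv_squares (m - k) = inv_squares (m - k - 1) + 1 / (real (m - k))\<^sup>2"
    by (intro inv_squares_step) auto
  moreover have "real (m - k) = real_of_int (int m - int k)" using True by simp
  ultimately have "inv_squares (m - k) = inv_squares (m - k - 1) + 1 / (real_of_int (int m - int k))\<^sup>2"
    by simp
  then show ?thesis
    unfolding child_up[OF True] jump_ratio_def fst_conv snd_conv by (simp add: ring_distribs diff_divide_distrib)
next
  case False
  with assms have less: "m < k" by simp
  then have "inv_squares (k - m) = inv_squares (k - m - 1) + 1 / (real (k - m))\<^sup>2"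
    by (intro inv_squares_step) auto
  moreover have "real (k - m) = real_of_int (- (int m - int k))" using less by simp
  ultimately have "inv_squares (k - m)
      = inv_squares (k - m - 1) + 1 / (real_of_int (- (int m - int k)))\<^sup>2"
    by simp
  then have "snd (child k (a, b) m) - fst (child k (a, b) m)
      = jump_ratio (- (int m - int k)) * (b - a)"
    unfolding child_down[OF less] jump_ratio_def fst_conv snd_conv by (simp add: ring_distribs diff_divide_distrib)
  then show ?thesis by (simp only: jump_ratio_minus)
qed

lemma child_up_bounds:
  assumes "a < b" "k < m"
  shows "a \<le> fst (child k (a, b) m)" "snd (child k (a, b) m) < (a + b) / 2"
proof -
  let ?c = "3 * (b - a) / pi\<^sup>2"
  have "?c > 0" using assms by simp
  then have "?c * inv_squares (m - k) < ?c * (pi\<^sup>2 / 6)"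
    by (intro mult_strict_left_mono inv_squares_less)
  also have "\<dots> = (b - a) / 2" by simp
  finally show "snd (child k (a, b) m) < (a + b) / 2"
    by (simp add: child_up[OF assms(2)] field_simps)
  show "a \<le> fst (child k (a, b) m)"
    using \<open>?c > 0\<close> inv_squares_nonneg assms by (simp add: child_up[OF assms(2)])
qed

text \<open>
  The downward children fit into the right half because the offset \<open>1 / (2 * k)\<^sup>2\<close> together with at
  most \<open>k\<close> terms of the series is dominated by \<open>k + 1\<close> terms of the series.
\<close>
lemma child_down_bounds:
  assumes "a < b" "m < k"
  shows "(a + b) / 2 < fst (child k (a, b) m)" "snd (child k (a, b) m) < b"
proof -
  let ?c = "3 * (b - a) / pi\<^sup>2"
  have c: "?c > 0" using assms by simp
  have "(real (Suc k))\<^sup>2 \<le> (2 * real k)\<^sup>2" using assms by (intro power_mono) auto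
  then have "1 / (2 * real k)\<^sup>2 \<le> 1 / (real (Suc k))\<^sup>2"
    using assms by (intro divide_left_mono) auto
  then have "1 / (2 * real k)\<^sup>2 + inv_squares (k - m) \<le> inv_squares (Suc k)"
    using inv_squares_mono[of "k - m" k] by (simp add: inv_squares_Suc)
  then have "1 / (2 * real k)\<^sup>2 + inv_squares (k - m) < pi\<^sup>2 / 6"
    using inv_squares_less[of "Suc k"] by simp
  then have "?c * (1 / (2 * real k)\<^sup>2 + inv_squares (k - m)) < ?c * (pi\<^sup>2 / 6)"
    using c by (rule mult_strict_left_mono)
  also have "\<dots> = (b - a) / 2" by simp
  finally show "(a + b) / 2 < fst (child k (a, b) m)"
    by (simp add: child_down[OF assms(2)] field_simps)
  have "0 < 1 / (2 * real k)\<^sup>2 + inv_squares (k - m - 1)"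
    using assms inv_squares_nonneg[of "k - m - 1"] by (intro add_pos_nonneg) auto
  with c have "0 < ?c * (1 / (2 * real k)\<^sup>2 + inv_squares (k - m - 1))" by (rule mult_pos_pos)
  then show "snd (child k (a, b) m) < b" by (simp add: child_down[OF assms(2)])
qed

text \<open>
  Strictness at the right endpoint makes the closure of a child lie in the half-open parent, so nested
  intersections along codes without repetitions are nonempty.
\<close>
lemma child_strict_subset:
  assumes "a < b" "m \<noteq> k"
  shows "a \<le> fst (child k (a, b) m)" "snd (child k (a, b) m) < b"
    "fst (child k (a, b) m) < snd (child k (a, b) m)"
proof -
  show "a \<le> fst (child k (a, b) m)" "snd (child k (a, b) m) < b"
    using child_up_bounds[of a b k m] child_down_bounds[of a b m k] assms
    by (cases "k < m"; fastforce)+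
  have "0 < jump_ratio (int m - int k) * (b - a)"
    using assms by (intro mult_pos_pos jump_ratio_pos) auto
  then show "fst (child k (a, b) m) < snd (child k (a, b) m)"
    using length_child[of m k a b] assms by linarith
qed

lemma children_separated:
  assumes "a < b" "m \<noteq> k" "m' \<noteq> k" "m \<noteq> m'"
  shows "snd (child k (a, b) m) \<le> fst (child k (a, b) m')
       \<or> snd (child k (a, b) m') \<le> fst (child k (a, b) m)"
proof -
  let ?c = "3 * (b - a) / pi\<^sup>2"
  have c: "?c > 0" using assms by simp
  have up: "snd (child k (a, b) i) \<le> fst (child k (a, b) j)" if "k < i" "i < j" for i j
  proof -
    have "?c * inv_squares (i - k) \<le> ?c * inv_squares (j - k - 1)"
      using c that by (intro mult_left_mono inv_squares_mono) auto
    with that show ?thesis by (simp add: child_up)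
  qed
  have down: "snd (child k (a, b) i) \<le> fst (child k (a, b) j)" if "i < j" "j < k" for i j
  proof -
    have "?c * (1 / (2 * real k)\<^sup>2 + inv_squares (k - j)) \<le> ?c * (1 / (2 * real k)\<^sup>2 + inv_squares (k - i - 1))"
      using c that by (intro mult_left_mono add_left_mono inv_squares_mono) auto
    with that show ?thesis by (simp add: child_down)
  qed
  have across: "snd (child k (a, b) i) \<le> fst (child k (a, b) j)" if "k < i" "j < k" for i j
    using child_up_bounds(2)[of a b k i] child_down_bounds(1)[of a b j k] that assms(1) by linarith
  consider "k < m" "k < m'" | "m < k" "m' < k" | "k < m" "m' < k" | "m < k" "k < m'"
    using assms by linarith
  then show ?thesis
    using up[of m m'] up[of m' m] down[of m m'] down[of m' m] across[of m m'] across[of m' m] assms(4)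
    by cases (metis nat_neq_iff)+
qed

lemma descend_snoc: "descend k J (ms @ [m]) = child (last (k # ms)) (descend k J ms) m"
  by (induction ms arbitrary: k J) auto

lemma endpoints_snoc: "ks \<noteq> [] \<Longrightarrow> endpoints (ks @ [m]) = child (last ks) (endpoints ks) m"
  by (cases ks) (auto simp: descend_snoc)

definition prefix_interval :: "(nat \<Rightarrow> nat) \<Rightarrow> nat \<Rightarrow> real \<times> real" where
  "prefix_interval \<kappa> n = endpoints (map \<kappa> [0..<Suc n])"

lemma prefix_interval_Suc:
  "prefix_interval \<kappa> (Suc n) = child (\<kappa> n) (prefix_interval \<kappa> n) (\<kappa> (Suc n))"
proof -
  have "map \<kappa> [0..<Suc (Suc n)] = map \<kappa> [0..<Suc n] @ [\<kappa> (Suc n)]" by simp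
  moreover have "endpoints (map \<kappa> [0..<Suc n] @ [\<kappa> (Suc n)])
      = child (last (map \<kappa> [0..<Suc n])) (endpoints (map \<kappa> [0..<Suc n])) (\<kappa> (Suc n))"
    by (rule endpoints_snoc) simp
  moreover have "last (map \<kappa> [0..<Suc n]) = \<kappa> n" by simp
  ultimately show ?thesis unfolding prefix_interval_def by metis
qed

lemma first_interval_proper:
  assumes "k \<ge> 1"
  shows "fst (first_interval k) < snd (first_interval k)"
proof -
  have "inv_squares (k - 1) < inv_squares k" using assms by (simp add: inv_squares_step)
  then have "3 / pi\<^sup>2 * inv_squares (k - 1) < 3 / pi\<^sup>2 * inv_squares k"
    by (intro mult_strict_left_mono) auto
  then show ?thesis
    by (simp add: first_interval_def sum_lessThan_inv_squares del: One_nat_def flip: inv_squares_def)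
qed

lemma first_interval_subset_unit:
  shows "{fst (first_interval k)..<snd (first_interval k)} \<subseteq> {0..1}"
proof -
  have "3 / pi\<^sup>2 * inv_squares k \<le> 3 / pi\<^sup>2 * (pi\<^sup>2 / 6)"
    using inv_squares_less[of k] by (intro mult_left_mono) auto
  also have "\<dots> = 1 / 2" by simp
  finally have "snd (first_interval k) \<le> 1 / 2" by (simp add: first_interval_def inv_squares_def)
  moreover have "0 \<le> fst (first_interval k)"
    using inv_squares_nonneg by (simp add: first_interval_def sum_lessThan_inv_squares del: One_nat_def)
  ultimately show ?thesis by auto
qed

lemma cantor_like_subset_unit: "cantor_like \<subseteq> {0..1}"
proof
  fix x assume "x \<in> cantor_like"
  then have "x \<in> \<Union> (level_intervals 1)" by (auto simp: cantor_like_def)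
  then obtain k where "x \<in> code_interval [k]"
    by (auto simp: level_intervals_def length_Suc_conv)
  then show "x \<in> {0..1}" using first_interval_subset_unit[of k] by (auto simp: code_interval_def)
qed

lemma prefix_interval_proper:
  assumes "\<kappa> 0 \<ge> 1" "\<And>i. \<kappa> (Suc i) \<noteq> \<kappa> i"
  shows "fst (prefix_interval \<kappa> n) < snd (prefix_interval \<kappa> n)"
proof (induction n)
  case 0
  then show ?case using first_interval_proper[OF assms(1)] by (simp add: prefix_interval_def)
next
  case (Suc n)
  then show ?case
    using child_strict_subset(3)[OF Suc assms(2)[of n]] by (simp add: prefix_interval_Suc)
qed

lemma prefix_interval_Suc_nested:
  assumes "\<kappa> 0 \<ge> 1" "\<And>i. \<kappa> (Suc i) \<noteq> \<kappa> i"
  shows "fst (prefix_interval \<kappa> n) \<le> fst (prefix_interval \<kappa> (Suc n))"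
    "snd (prefix_interval \<kappa> (Suc n)) < snd (prefix_interval \<kappa> n)"
  using child_strict_subset(1,2)[OF prefix_interval_proper[OF assms, of n] assms(2)[of n]]
  by (simp_all add: prefix_interval_Suc)

lemma prefix_interval_nested:
  assumes "\<kappa> 0 \<ge> 1" "\<And>i. \<kappa> (Suc i) \<noteq> \<kappa> i" "n \<le> m"
  shows "fst (prefix_interval \<kappa> n) \<le> fst (prefix_interval \<kappa> m)"
    "snd (prefix_interval \<kappa> m) \<le> snd (prefix_interval \<kappa> n)"
proof -
  note nested = prefix_interval_Suc_nested[OF assms(1,2)]
  show "fst (prefix_interval \<kappa> n) \<le> fst (prefix_interval \<kappa> m)"
    using nested(1) assms(3) by (rule lift_Suc_mono_le[of "\<lambda>n. fst (prefix_interval \<kappa> n)"])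
  show "snd (prefix_interval \<kappa> m) \<le> snd (prefix_interval \<kappa> n)"
    using less_imp_le[OF nested(2)] assms(3)
    by (rule lift_Suc_antimono_le[of "\<lambda>n. snd (prefix_interval \<kappa> n)"])
qed

definition limit_point :: "(nat \<Rightarrow> nat) \<Rightarrow> real" where
  "limit_point \<kappa> = (SUP n. fst (prefix_interval \<kappa> n))"

lemma limit_point_in_prefix_interval:
  assumes "\<kappa> 0 \<ge> 1" "\<And>i. \<kappa> (Suc i) \<noteq> \<kappa> i"
  shows "fst (prefix_interval \<kappa> n) \<le> limit_point \<kappa>" "limit_point \<kappa> < snd (prefix_interval \<kappa> n)"
proof -
  have le: "fst (prefix_interval \<kappa> m) \<le> snd (prefix_interval \<kappa> n)" for m n
  proof -
    have "fst (prefix_interval \<kappa> m) \<le> fst (prefix_interval \<kappa> (max m n))"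
      by (intro prefix_interval_nested assms) auto
    also have "\<dots> \<le> snd (prefix_interval \<kappa> (max m n))"
      by (intro less_imp_le prefix_interval_proper assms)
    also have "\<dots> \<le> snd (prefix_interval \<kappa> n)"
      by (intro prefix_interval_nested assms) auto
    finally show ?thesis .
  qed
  have "bdd_above (range (\<lambda>n. fst (prefix_interval \<kappa> n)))"
    using le by (intro bdd_aboveI[of _ "snd (prefix_interval \<kappa> 0)"]) auto
  then show "fst (prefix_interval \<kappa> n) \<le> limit_point \<kappa>"
    unfolding limit_point_def by (intro cSUP_upper) auto
  have "limit_point \<kappa> \<le> snd (prefix_interval \<kappa> (Suc n))"
    unfolding limit_point_def using le by (intro cSUP_least) auto
  also have "\<dots> < snd (prefix_interval \<kappa> n)" by (rule prefix_interval_Suc_nested[OF assms])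
  finally show "limit_point \<kappa> < snd (prefix_interval \<kappa> n)" .
qed

lemma limit_point_dissipative:
  assumes pos: "\<And>i. \<kappa> i \<ge> 1" and neq: "\<And>i. \<kappa> (Suc i) \<noteq> \<kappa> i"
    and lim: "filterlim \<kappa> at_top sequentially"
  shows "limit_point \<kappa> \<in> dissipative_points"
proof -
  have mem: "limit_point \<kappa> \<in> code_interval (map \<kappa> [0..<n])" if "n \<ge> 1" for n
  proof -
    from that obtain m where n: "n = Suc m" by (cases n) auto
    show ?thesis
      using limit_point_in_prefix_interval[of \<kappa> m, OF pos neq]
      unfolding n code_interval_def prefix_interval_def by simp
  qed
  have not0: "\<kappa> i \<noteq> 0" for i using pos[of i] by simp
  then have code: "is_code (limit_point \<kappa>) \<kappa>"
    using mem pos by (auto simp: is_code_def admissible_seq_def)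
  have "admissible (map \<kappa> [0..<n])" if "n \<ge> 1" for n
    using that not0 pos[of 0] by (auto simp: admissible_def hd_map)
  then have "limit_point \<kappa> \<in> cantor_like"
    using mem by (fastforce simp: cantor_like_def level_intervals_def)
  with code lim show ?thesis by (auto simp: dissipative_points_def)
qed

text \<open>
  At the first index where the codes differ the intervals are two children of the same parent.
\<close>
lemma prefix_intervals_separated:
  assumes \<kappa>: "\<kappa> 0 \<ge> 1" "\<And>i. \<kappa> (Suc i) \<noteq> \<kappa> i"
    and \<kappa>': "\<kappa>' 0 \<ge> 1" "\<And>i. \<kappa>' (Suc i) \<noteq> \<kappa>' i"
    and eq: "\<kappa> 0 = \<kappa>' 0" and diff: "\<kappa> i \<noteq> \<kappa>' i" and "i \<le> n"
  shows "snd (prefix_interval \<kappa> n) \<le> fst (prefix_interval \<kappa>' n)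
       \<or> snd (prefix_interval \<kappa>' n) \<le> fst (prefix_interval \<kappa> n)"
proof -
  define j where "j = (LEAST j. \<kappa> j \<noteq> \<kappa>' j)"
  have j: "\<kappa> j \<noteq> \<kappa>' j" unfolding j_def by (rule LeastI) fact
  have "j \<le> i" unfolding j_def by (rule Least_le) fact
  have least: "\<kappa> l = \<kappa>' l" if "l < j" for l using that not_less_Least unfolding j_def by blast
  from j eq obtain m where m: "j = Suc m" by (cases j) auto
  have same: "prefix_interval \<kappa>' m = prefix_interval \<kappa> m"
    unfolding prefix_interval_def using least m by (intro arg_cong[of _ _ endpoints] map_cong) auto
  have "snd (prefix_interval \<kappa> j) \<le> fst (prefix_interval \<kappa>' j)
      \<or> snd (prefix_interval \<kappa>' j) \<le> fst (prefix_interval \<kappa> j)"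
    using children_separated[OF prefix_interval_proper[OF \<kappa>, of m], of "\<kappa> j" "\<kappa> m" "\<kappa>' j"]
      \<kappa>(2)[of m] \<kappa>'(2)[of m] least[of m] j
    by (simp add: m prefix_interval_Suc same)
  moreover have "j \<le> n" using \<open>j \<le> i\<close> \<open>i \<le> n\<close> by simp
  ultimately show ?thesis
    using prefix_interval_nested[OF \<kappa> \<open>j \<le> n\<close>] prefix_interval_nested[OF \<kappa>' \<open>j \<le> n\<close>] by linarith
qed

lemma length_prefix_interval:
  assumes "\<And>i. \<kappa> (Suc i) \<noteq> \<kappa> i"
  shows "snd (prefix_interval \<kappa> n) - fst (prefix_interval \<kappa> n) =
    (\<Prod>i<n. jump_ratio (int (\<kappa> (Suc i)) - int (\<kappa> i))) *
      (snd (first_interval (\<kappa> 0)) - fst (first_interval (\<kappa> 0)))"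
proof (induction n)
  case 0
  then show ?case by (simp add: prefix_interval_def)
next
  case (Suc n)
  then show ?case
    using length_child[of "\<kappa> (Suc n)" "\<kappa> n" "fst (prefix_interval \<kappa> n)" "snd (prefix_interval \<kappa> n)"]
      assms[of n]
    by (simp add: prefix_interval_Suc)
qed

section \<open>Dimension of the dissipative set\<close>

text \<open>
  A sequence \<open>\<omega>\<close> of words is turned into the code \<open>\<kappa> \<omega>\<close> whose successive differences are the letters
  of the concatenated words.
\<close>
lemma hausdorff_measure_dissipative_points:
  assumes s: "0 < s" "s < 1"
  shows "hausdorff_measure s dissipative_points \<noteq> 0"
proof -
  obtain W :: "int list set" and L :: nat and M :: int and \<rho> :: real
    where W: "finite W" "W \<noteq> {}" and L: "0 < L" and \<rho>: "0 < \<rho>" "\<rho> < 1"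
      and card: "1 \<le> real (card W) * \<rho> powr s"
      and word: "\<And>w. w \<in> W \<Longrightarrow> length w = L" "\<And>w. w \<in> W \<Longrightarrow> set w \<subseteq> {-M..M} - {0}"
        "\<And>w. w \<in> W \<Longrightarrow> 1 \<le> sum_list w" "\<And>w. w \<in> W \<Longrightarrow> prod_list (map jump_ratio w) = \<rho>"
    using exists_word_set[OF s] by metis
  have nth: "w ! j \<noteq> 0" "- M \<le> w ! j" "0 \<le> M" if "w \<in> W" "j < L" for w j
  proof -
    have "w ! j \<in> set w" using that word(1) by simp
    then show "w ! j \<noteq> 0" "- M \<le> w ! j" "0 \<le> M" using word(2)[OF that(1)] by auto
  qed
  obtain w0 where "w0 \<in> W" using W by blast
  then have M: "0 \<le> M" using nth(3) L by blast
  \<comment> \<open>within one word the walk descends by at most \<open>L * M\<close>, so all indices stay positive\<close>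
  define k0 where "k0 = int L * M + 1"
  have "k0 \<ge> 1" using M by (simp add: k0_def)
  define jump where "jump \<omega> j = \<omega> (j div L) ! (j mod L)" for \<omega> :: "nat \<Rightarrow> int list" and j
  define height where "height \<omega> i = k0 + (\<Sum>j<i. jump \<omega> j)" for \<omega> i
  define \<kappa> where "\<kappa> \<omega> i = nat (height \<omega> i)" for \<omega> i
  have jump_block: "jump \<omega> (n * L + j) = \<omega> n ! j" if "j < L" for \<omega> n j
    using that by (simp add: jump_def)
  have jump_nz: "jump \<omega> j \<noteq> 0" if "range \<omega> \<subseteq> W" for \<omega> j
    using nth(1)[of "\<omega> (j div L)" "j mod L"] that L by (auto simp: jump_def)
  have block: "(\<Sum>j<n * L + r. jump \<omega> j) = (\<Sum>j<n * L. jump \<omega> j) + (\<Sum>j<r. \<omega> n ! j)"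
    if "r \<le> L" for \<omega> n r
    using that by (induction r) (simp_all add: jump_block)
  have blocks: "int n \<le> (\<Sum>j<n * L. jump \<omega> j)" if \<omega>: "range \<omega> \<subseteq> W" for \<omega> n
  proof (induction n)
    case (Suc n)
    have "\<omega> n \<in> W" using \<omega> by auto
    then have "1 \<le> (\<Sum>j<L. \<omega> n ! j)"
      using word(1,3) by (simp add: sum_list_sum_nth atLeast0LessThan)
    moreover have "(\<Sum>j<Suc n * L. jump \<omega> j) = (\<Sum>j<n * L. jump \<omega> j) + (\<Sum>j<L. \<omega> n ! j)"
      using block[where r = L and n = n and \<omega> = \<omega>] by (simp add: add.commute)
    ultimately show ?case using Suc by simp
  qed simp
  have height_ge: "int (i div L) + 1 \<le> height \<omega> i" if \<omega>: "range \<omega> \<subseteq> W" for \<omega> i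
  proof -
    have wW: "\<omega> (i div L) \<in> W" using \<omega> by auto
    have r: "i mod L < L" using L by simp
    have "int (i mod L) * M \<le> int L * M" using r M by (intro mult_right_mono) auto
    moreover have "(\<Sum>j<i mod L. - M) \<le> (\<Sum>j<i mod L. \<omega> (i div L) ! j)"
      using r by (intro sum_mono nth(2)[OF wW]) auto
    ultimately have "- (int L * M) \<le> (\<Sum>j<i mod L. \<omega> (i div L) ! j)" by simp
    moreover have "(\<Sum>j<i. jump \<omega> j)
        = (\<Sum>j<i div L * L. jump \<omega> j) + (\<Sum>j<i mod L. \<omega> (i div L) ! j)"
      using block[where r = "i mod L" and n = "i div L" and \<omega> = \<omega>] r by simp
    ultimately show ?thesis using blocks[OF \<omega>, of "i div L"] by (simp add: height_def k0_def)
  qed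
  have int_\<kappa>: "int (\<kappa> \<omega> i) = height \<omega> i" if "range \<omega> \<subseteq> W" for \<omega> i
    using height_ge[OF that, of i] by (simp add: \<kappa>_def)
  have \<kappa>_jump: "int (\<kappa> \<omega> (Suc i)) - int (\<kappa> \<omega> i) = jump \<omega> i" if "range \<omega> \<subseteq> W" for \<omega> i
    by (simp add: int_\<kappa>[OF that] height_def)
  have \<kappa>_ge: "i div L + 1 \<le> \<kappa> \<omega> i" if "range \<omega> \<subseteq> W" for \<omega> i
    using height_ge[OF that, of i] int_\<kappa>[OF that, of i] by linarith
  have \<kappa>_pos: "1 \<le> \<kappa> \<omega> i" if "range \<omega> \<subseteq> W" for \<omega> i using \<kappa>_ge[OF that, of i] by simp
  have \<kappa>_neq: "\<kappa> \<omega> (Suc i) \<noteq> \<kappa> \<omega> i" if "range \<omega> \<subseteq> W" for \<omega> i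
    using jump_nz[OF that, of i] \<kappa>_jump[OF that, of i] by auto
  have \<kappa>_0: "\<kappa> \<omega> 0 = nat k0" for \<omega> by (simp add: \<kappa>_def height_def)
  have \<kappa>_lim: "filterlim (\<kappa> \<omega>) at_top sequentially" if "range \<omega> \<subseteq> W" for \<omega>
    unfolding filterlim_at_top
  proof
    fix Z
    have "Z \<le> \<kappa> \<omega> i" if i: "i \<ge> Z * L" for i
      using div_le_mono[OF i, of L] \<kappa>_ge[OF \<open>range \<omega> \<subseteq> W\<close>, of i] L by simp
    then show "eventually (\<lambda>i. Z \<le> \<kappa> \<omega> i) sequentially" by (auto simp: eventually_sequentially)
  qed
  define r where "r = snd (first_interval (nat k0)) - fst (first_interval (nat k0))"
  have "r > 0" using first_interval_proper[of "nat k0"] \<open>k0 \<ge> 1\<close> by (simp add: r_def)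
  have ratio: "(\<Prod>j<n * L. jump_ratio (jump \<omega> j)) = \<rho> ^ n" if \<omega>: "range \<omega> \<subseteq> W" for \<omega> n
  proof (induction n)
    case (Suc n)
    have "(\<Prod>j<n * L + r. jump_ratio (jump \<omega> j))
        = (\<Prod>j<n * L. jump_ratio (jump \<omega> j)) * (\<Prod>j<r. jump_ratio (\<omega> n ! j))" if "r \<le> L" for r
      using that by (induction r) (simp_all add: jump_block mult.assoc)
    from this[of L] have "(\<Prod>j<Suc n * L. jump_ratio (jump \<omega> j))
        = \<rho> ^ n * (\<Prod>j<L. jump_ratio (\<omega> n ! j))"
      using Suc by (simp add: add.commute)
    moreover have "\<omega> n \<in> W" using \<omega> by auto
    then have "(\<Prod>j<L. jump_ratio (\<omega> n ! j)) = \<rho>"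
      using word(1)[of "\<omega> n"] word(4)[of "\<omega> n"] by (simp add: prod.list_conv_set_nth atLeast0LessThan)
    ultimately show ?case by simp
  qed simp
  have length: "snd (prefix_interval (\<kappa> \<omega>) (n * L)) - fst (prefix_interval (\<kappa> \<omega>) (n * L)) = \<rho> ^ n * r"
    if "range \<omega> \<subseteq> W" for \<omega> n
    using length_prefix_interval[of "\<kappa> \<omega>" "n * L", OF \<kappa>_neq[OF that]] ratio[OF that, of n]
    by (simp add: \<kappa>_jump[OF that] \<kappa>_0 r_def)
  show ?thesis
  proof (rule hausdorff_measure_pos[OF W \<rho> s(1) card \<open>r > 0\<close>,
        where a = "\<lambda>n \<omega>. fst (prefix_interval (\<kappa> \<omega>) (n * L))" and x = "\<lambda>\<omega>. limit_point (\<kappa> \<omega>)"])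
    fix \<omega> :: "nat \<Rightarrow> int list" assume \<omega>: "range \<omega> \<subseteq> W"
    show "limit_point (\<kappa> \<omega>) \<in> dissipative_points"
      by (intro limit_point_dissipative \<kappa>_pos \<kappa>_neq \<kappa>_lim \<omega>)
    fix n
    show "fst (prefix_interval (\<kappa> \<omega>) (n * L)) \<le> limit_point (\<kappa> \<omega>)
        \<and> limit_point (\<kappa> \<omega>) < fst (prefix_interval (\<kappa> \<omega>) (n * L)) + \<rho> ^ n * r"
      using limit_point_in_prefix_interval[of "\<kappa> \<omega>" "n * L", OF \<kappa>_pos[OF \<omega>] \<kappa>_neq[OF \<omega>]]
        length[OF \<omega>, of n] by simp
  next
    fix n and \<omega> \<omega>' :: "nat \<Rightarrow> int list"
    assume \<omega>: "range \<omega> \<subseteq> W" and \<omega>': "range \<omega>' \<subseteq> W" and "\<exists>i<n. \<omega> i \<noteq> \<omega>' i"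
    then obtain i where i: "i < n" "\<omega> i \<noteq> \<omega>' i" by blast
    have "\<omega> i \<in> W" "\<omega>' i \<in> W" using \<omega> \<omega>' by auto
    then obtain t where t: "t < L" "\<omega> i ! t \<noteq> \<omega>' i ! t"
      using i(2) word(1) by (metis nth_equalityI)
    define j where "j = i * L + t"
    have "Suc j \<le> Suc i * L" using t by (simp add: j_def)
    also have "\<dots> \<le> n * L" using i by (intro mult_right_mono) auto
    finally have j: "Suc j \<le> n * L" .
    have "jump \<omega> j \<noteq> jump \<omega>' j" using t by (simp add: j_def jump_block)
    then have "\<kappa> \<omega> j \<noteq> \<kappa> \<omega>' j \<or> \<kappa> \<omega> (Suc j) \<noteq> \<kappa> \<omega>' (Suc j)"
      using \<kappa>_jump[OF \<omega>, of j] \<kappa>_jump[OF \<omega>', of j] by auto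
    then obtain l where l: "\<kappa> \<omega> l \<noteq> \<kappa> \<omega>' l" "l \<le> n * L"
      using j by (meson Suc_leD)
    have "snd (prefix_interval (\<kappa> \<omega>) (n * L)) \<le> fst (prefix_interval (\<kappa> \<omega>') (n * L))
       \<or> snd (prefix_interval (\<kappa> \<omega>') (n * L)) \<le> fst (prefix_interval (\<kappa> \<omega>) (n * L))"
      by (rule prefix_intervals_separated[OF \<kappa>_pos[OF \<omega>] \<kappa>_neq[OF \<omega>] \<kappa>_pos[OF \<omega>'] \<kappa>_neq[OF \<omega>'] _ l])
         (simp add: \<kappa>_0)
    then show "\<rho> ^ n * r \<le> \<bar>fst (prefix_interval (\<kappa> \<omega>) (n * L)) - fst (prefix_interval (\<kappa> \<omega>') (n * L))\<bar>"
      using length[OF \<omega>, of n] length[OF \<omega>', of n] by linarith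
  qed
qed

theorem mainTheorem1:
  "hausdorff_dim dissipative_points = 1 \<and> hausdorff_dim cantor_like = 1"
proof -
  have sub: "dissipative_points \<subseteq> cantor_like" by (auto simp: dissipative_points_def)
  have "dissipative_points \<noteq> {}"
    using hausdorff_measure_dissipative_points[of "1 / 2"] hausdorff_measure_empty[of "1 / 2"] by auto
  then have pos: "hausdorff_measure s dissipative_points \<noteq> 0" if "0 \<le> s" "s < 1" for s
    using that hausdorff_measure_dissipative_points[of s]
      hausdorff_measure_0_nonempty[of dissipative_points]
    by (cases "s = 0") simp_all
  have "hausdorff_measure s cantor_like \<noteq> 0" if "0 \<le> s" "s < 1" for s
    using hausdorff_measure_mono[OF sub, of s] pos[OF that] by auto
  then have "1 \<le> hausdorff_dim cantor_like" by (rule hausdorff_dim_ge_1)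
  moreover have "1 \<le> hausdorff_dim dissipative_points" using pos by (rule hausdorff_dim_ge_1)
  moreover have "hausdorff_dim cantor_like \<le> 1"
    by (rule hausdorff_dim_le_1[OF cantor_like_subset_unit])
  moreover have "hausdorff_dim dissipative_points \<le> 1"
    by (rule hausdorff_dim_le_1[OF order_trans[OF sub cantor_like_subset_unit]])
  ultimately show ?thesis by (intro conjI antisym)
qed

end
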